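(* For every real $\beta>1$, the kernel $\alpha$-point rounding algorithm with parameter $\beta$ described below is a $\beta^2/(\beta-1)$-approximation for min sum set cover; that is, for every instance the expected total cover time of its output is at most $\frac{\beta^2}{\beta-1}$ times the optimum. In particular, $\beta=2$ gives a $4$-approximation.
   Context: Min sum set cover (MSSC): input a finite hypergraph $H=(V,E)$, $n=|V|$; a solution is a bijection $\sigma:V\to\{1,\dots,n\}$, the cover time of $e$ is $\min_{v\in e}\sigma(v)$, and the objective is the sum of cover times. LP relaxation: variables $x_{v,t}\ge0$, $u_{e,t}\ge0$ ($v\in V,e\in E,t\in\{1,\dots,n\}$), minimize $\sum_{e,t}u_{e,t}$ subject to $\sum_v x_{v,t}\le1$ for all $t$ and $u_{e,t}+\sum_{v\in e}\sum_{t'<t}x_{v,t'}\ge1$ for all $e,t$ (set $x_{v,t}=0$ for $t>n$). Algorithm with parameter $\beta$: (1) compute an optimal LP solution $x$; (2) for every vertex $v$ and every integer $t\ge1$ set $z_{v,t}=\frac{\beta}{t}\sum_{t'\le t}x_{v,t'}$; (3) for each $v$ independently draw $\alpha_v$ uniformly from $[0,1]$ and let $\tau(v)$ be the earliest integer $t\ge1$ with $\sum_{t'\le t}z_{v,t'}\ge\alpha_v$ (with $\tau(v)=\infty$ if none exists); (4) output the ordering of $V$ obtained by sorting vertices by $\tau(v)$, breaking ties uniformly at random. *)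

theory Defs
  imports "HOL-Probability.Probability"
begin

section \<open>Min sum set cover\<close>

definition mssc_instance :: "'v set \<Rightarrow> 'v set set \<Rightarrow> bool" where
  "mssc_instance V E \<longleftrightarrow> finite V \<and> E \<subseteq> Pow V \<and> {} \<notin> E"

text \<open>Bijections are extensional, so that each ordering of \<open>V\<close> is represented by exactly one
  function and the uniform choice among orderings below is a choice from a finite set.\<close>

definition orderings :: "'v set \<Rightarrow> ('v \<Rightarrow> nat) set" where
  "orderings V = {\<sigma> \<in> extensional V. bij_betw \<sigma> V {1..card V}}"

definition cover_time :: "('v \<Rightarrow> nat) \<Rightarrow> 'v set \<Rightarrow> nat" where
  "cover_time \<sigma> e = Min (\<sigma> ` e)"

definition total_cover_time :: "'v set set \<Rightarrow> ('v \<Rightarrow> nat) \<Rightarrow> nat" where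
  "total_cover_time E \<sigma> = (\<Sum>e\<in>E. cover_time \<sigma> e)"

definition mssc_opt :: "'v set \<Rightarrow> 'v set set \<Rightarrow> nat" where
  "mssc_opt V E = Min (total_cover_time E ` orderings V)"


section \<open>The LP relaxation\<close>

definition lp_feasible ::
  "'v set \<Rightarrow> 'v set set \<Rightarrow> ('v \<Rightarrow> nat \<Rightarrow> real) \<Rightarrow> ('v set \<Rightarrow> nat \<Rightarrow> real) \<Rightarrow> bool" where
  "lp_feasible V E x u \<longleftrightarrow>
     (\<forall>v\<in>V. \<forall>t\<in>{1..card V}. 0 \<le> x v t) \<and>
     (\<forall>e\<in>E. \<forall>t\<in>{1..card V}. 0 \<le> u e t) \<and>
     (\<forall>t\<in>{1..card V}. (\<Sum>v\<in>V. x v t) \<le> 1) \<and>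
     (\<forall>e\<in>E. \<forall>t\<in>{1..card V}. u e t + (\<Sum>v\<in>e. \<Sum>t'\<in>{1..<t}. x v t') \<ge> 1)"

definition lp_value :: "'v set \<Rightarrow> 'v set set \<Rightarrow> ('v set \<Rightarrow> nat \<Rightarrow> real) \<Rightarrow> real" where
  "lp_value V E u = (\<Sum>e\<in>E. \<Sum>t\<in>{1..card V}. u e t)"

definition lp_optimal ::
  "'v set \<Rightarrow> 'v set set \<Rightarrow> ('v \<Rightarrow> nat \<Rightarrow> real) \<Rightarrow> ('v set \<Rightarrow> nat \<Rightarrow> real) \<Rightarrow> bool" where
  "lp_optimal V E x u \<longleftrightarrow> lp_feasible V E x u \<and>
     (\<forall>x' u'. lp_feasible V E x' u' \<longrightarrow> lp_value V E u \<le> lp_value V E u')"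


section \<open>Kernel \<open>\<alpha>\<close>-point rounding\<close>

text \<open>The LP constrains \<open>x v t\<close> only for \<open>1 \<le> t \<le> n\<close>; beyond the horizon it is read as 0.\<close>

definition zero_ext :: "nat \<Rightarrow> (nat \<Rightarrow> real) \<Rightarrow> nat \<Rightarrow> real" where
  "zero_ext n y t = (if t \<in> {1..n} then y t else 0)"

definition kernel_z :: "real \<Rightarrow> nat \<Rightarrow> (nat \<Rightarrow> real) \<Rightarrow> nat \<Rightarrow> real" where
  "kernel_z \<beta> n y t = \<beta> / real t * (\<Sum>t'\<in>{1..t}. zero_ext n y t')"

definition alpha_point :: "(nat \<Rightarrow> real) \<Rightarrow> real \<Rightarrow> enat" where
  "alpha_point z a =
     (if \<exists>t\<ge>1. (\<Sum>t'\<in>{1..t}. z t') \<ge> a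
      then enat (LEAST t. 1 \<le> t \<and> (\<Sum>t'\<in>{1..t}. z t') \<ge> a) else \<infinity>)"

definition sorted_orderings :: "'v set \<Rightarrow> ('v \<Rightarrow> enat) \<Rightarrow> ('v \<Rightarrow> nat) set" where
  "sorted_orderings V \<tau> = {\<sigma> \<in> orderings V. \<forall>v\<in>V. \<forall>w\<in>V. \<tau> v < \<tau> w \<longrightarrow> \<sigma> v < \<sigma> w}"

text \<open>The distribution of the output ordering, given the LP solution \<open>x\<close>. Sorting by \<open>\<tau>\<close> with
  ties broken uniformly at random is a uniform choice among the orderings compatible with \<open>\<tau>\<close>.\<close>

definition kernel_alpha_rounding ::
  "real \<Rightarrow> 'v set \<Rightarrow> ('v \<Rightarrow> nat \<Rightarrow> real) \<Rightarrow> ('v \<Rightarrow> nat) measure" where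
  "kernel_alpha_rounding \<beta> V x =
     (\<Pi>\<^sub>M v\<in>V. uniform_measure lborel {0..1}) \<bind>
     (\<lambda>\<alpha>. measure_pmf (pmf_of_set
        (sorted_orderings V (\<lambda>v. alpha_point (kernel_z \<beta> (card V) (x v)) (\<alpha> v)))))"


section \<open>Well-definedness\<close>

lemma finite_orderings:
  assumes "finite V"
  shows "finite (orderings V)"
proof (rule finite_subset)
  show "orderings V \<subseteq> PiE V (\<lambda>_. {1..card V})"
    by (auto simp: orderings_def PiE_def bij_betw_def)
qed (use assms in \<open>auto intro: finite_PiE\<close>)

lemma sorted_orderings_nonempty:
  assumes "finite V"
  shows "sorted_orderings V \<tau> \<noteq> {}"
  using assms
proof (induction V rule: finite_ranking_induct[where f = \<tau>])
  case empty
  have "(\<lambda>_. undefined) \<in> sorted_orderings {} \<tau>"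
    by (auto simp: sorted_orderings_def orderings_def bij_betw_def)
  then show ?case by blast
next
  case (insert v S)
  show ?case
  proof (cases "v \<in> S")
    case True
    then show ?thesis using insert by (simp add: insert_absorb)
  next
    case False
    from insert.IH obtain \<sigma> where \<sigma>: "\<sigma> \<in> extensional S" "bij_betw \<sigma> S {1..card S}"
      "\<forall>a\<in>S. \<forall>b\<in>S. \<tau> a < \<tau> b \<longrightarrow> \<sigma> a < \<sigma> b"
      by (auto simp: sorted_orderings_def orderings_def)
    let ?s = "\<sigma>(v := Suc (card S))"
    have le: "\<sigma> a < Suc (card S)" if "a \<in> S" for a
      using bij_betwE[OF \<sigma>(2)] that by fastforce
    have "bij_betw ?s S {1..card S}"
      using \<sigma>(2) False by (subst bij_betw_cong[of S ?s \<sigma>]) auto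
    then have "bij_betw ?s (S \<union> {v}) ({1..card S} \<union> {?s v})"
      by (intro notIn_Un_bij_betw[OF False]) auto
    moreover have "{1..card S} \<union> {?s v} = {1..card (insert v S)}"
      using False insert(1) by auto
    ultimately have "bij_betw ?s (insert v S) {1..card (insert v S)}" by simp
    moreover have "?s \<in> extensional (insert v S)"
      using \<sigma>(1) by (auto simp: extensional_def)
    moreover have "\<forall>a\<in>insert v S. \<forall>b\<in>insert v S. \<tau> a < \<tau> b \<longrightarrow> ?s a < ?s b"
      using \<sigma>(3) le insert(2) False by (auto simp: less_le_not_le[of "\<tau> _"])
    ultimately have "?s \<in> sorted_orderings (insert v S) \<tau>"
      by (simp add: sorted_orderings_def orderings_def)
    then show ?thesis by blast
  qed
qed

lemma measurable_alpha_point [measurable]: "alpha_point z \<in> borel \<rightarrow>\<^sub>M count_space UNIV"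
  unfolding alpha_point_def by measurable

lemma measurable_rounding_kernel:
  assumes "finite V"
  shows "(\<lambda>\<alpha>. measure_pmf (pmf_of_set (sorted_orderings V (\<lambda>v. alpha_point (z v) (\<alpha> v)))))
    \<in> (\<Pi>\<^sub>M v\<in>V. uniform_measure lborel {0..1}) \<rightarrow>\<^sub>M subprob_algebra (count_space UNIV)"
    (is "_ \<in> ?M \<rightarrow>\<^sub>M _")
proof -
  let ?S = "\<lambda>\<alpha>. sorted_orderings V (\<lambda>v. alpha_point (z v) (\<alpha> v))"
  have "?S \<in> ?M \<rightarrow>\<^sub>M count_space (Pow (orderings V))"
  proof (rule iffD2[OF measurable_count_space_eq2])
    show "finite (Pow (orderings V))"
      using finite_orderings[OF assms] by simp
    have "?S -` {A} \<inter> space ?M \<in> sets ?M" if "A \<subseteq> orderings V" for A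
    proof -
      have "?S -` {A} \<inter> space ?M = {\<alpha> \<in> space ?M. \<forall>\<sigma>\<in>orderings V. (\<sigma> \<in> A) =
          (\<forall>v\<in>V. \<forall>w\<in>V. alpha_point (z v) (\<alpha> v) < alpha_point (z w) (\<alpha> w) \<longrightarrow> \<sigma> v < \<sigma> w)}"
      proof -
        have "sorted_orderings V \<tau> = A \<longleftrightarrow> (\<forall>\<sigma>\<in>orderings V. (\<sigma> \<in> A) =
          (\<forall>v\<in>V. \<forall>w\<in>V. \<tau> v < \<tau> w \<longrightarrow> \<sigma> v < \<sigma> w))" for \<tau>
          using that unfolding sorted_orderings_def by blast
        then show ?thesis by (simp add: vimage_def Int_def conj_commute)
      qed
      also have "\<dots> \<in> sets ?M"
      proof -
        have ap: "(\<lambda>\<alpha>. alpha_point (z v) (\<alpha> v)) \<in> ?M \<rightarrow>\<^sub>M count_space UNIV"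
          if "v \<in> V" for v
        proof -
          have "(\<lambda>\<alpha>. \<alpha> v) \<in> ?M \<rightarrow>\<^sub>M borel"
            using measurable_component_singleton[OF that, of "\<lambda>_. uniform_measure lborel {0..1::real}"]
            by (simp cong: measurable_cong_sets)
          then show ?thesis by measurable
        qed
        have "Measurable.pred ?M (\<lambda>\<alpha>. alpha_point (z v) (\<alpha> v) < alpha_point (z w) (\<alpha> w))"
          if "v \<in> V" "w \<in> V" for v w
          by (rule measurable_compose_countable[OF _ ap[OF that(1)],
                where f = "\<lambda>i \<alpha>. i < alpha_point (z w) (\<alpha> w)"])
             (rule measurable_compose[OF ap[OF that(2)]], simp)
        then have "Measurable.pred ?M (\<lambda>\<alpha>. \<forall>\<sigma>\<in>orderings V. (\<sigma> \<in> A) =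
            (\<forall>v\<in>V. \<forall>w\<in>V. alpha_point (z v) (\<alpha> v) < alpha_point (z w) (\<alpha> w) \<longrightarrow> \<sigma> v < \<sigma> w))"
          by (intro pred_intros_finite(3) pred_intros_logic(4,6)
              finite_orderings[OF assms] assms) simp_all
        then show ?thesis by (simp add: pred_def)
      qed
      finally show ?thesis .
    qed
    then show "?S \<in> space ?M \<rightarrow> Pow (orderings V) \<and>
        (\<forall>A\<in>Pow (orderings V). ?S -` {A} \<inter> space ?M \<in> sets ?M)"
      by (auto simp: sorted_orderings_def)
  qed
  moreover have "(\<lambda>A. measure_pmf (pmf_of_set A)) \<in>
      count_space (Pow (orderings V)) \<rightarrow>\<^sub>M subprob_algebra (count_space UNIV)"
    by (auto simp: space_subprob_algebra intro: prob_space_imp_subprob_space prob_space_measure_pmf)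
  ultimately show ?thesis by (rule measurable_compose)
qed

lemma prob_space_alpha: "prob_space (\<Pi>\<^sub>M v\<in>V. uniform_measure lborel {0..1::real})"
  by (intro prob_space_PiM prob_space_uniform_measure) auto

lemma prob_space_kernel_alpha_rounding:
  assumes "finite V"
  shows "prob_space (kernel_alpha_rounding \<beta> V x)"
  unfolding kernel_alpha_rounding_def
  by (rule prob_space.prob_space_bind[OF prob_space_alpha _ measurable_rounding_kernel[OF assms]])
     (simp add: prob_space_measure_pmf)

lemma sets_kernel_alpha_rounding: "sets (kernel_alpha_rounding \<beta> V x) = UNIV"
proof -
  have "sets (kernel_alpha_rounding \<beta> V x) = sets (count_space UNIV)"
    unfolding kernel_alpha_rounding_def
    by (rule sets_bind) (use prob_space.not_empty[OF prob_space_alpha] in auto)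
  then show ?thesis by simp
qed

lemma AE_kernel_alpha_rounding_orderings:
  assumes "finite V"
  shows "AE \<sigma> in kernel_alpha_rounding \<beta> V x. \<sigma> \<in> orderings V"
proof -
  have "AE \<sigma> in measure_pmf (pmf_of_set (sorted_orderings V \<tau>)). \<sigma> \<in> orderings V" for \<tau>
  proof -
    have "finite (sorted_orderings V \<tau>)"
      using finite_orderings[OF assms] by (simp add: sorted_orderings_def)
    then show ?thesis
      using sorted_orderings_nonempty[OF assms]
      by (simp add: AE_measure_pmf_iff set_pmf_of_set) (simp add: sorted_orderings_def)
  qed
  then show ?thesis
    unfolding kernel_alpha_rounding_def
    by (subst AE_bind[OF measurable_rounding_kernel[OF assms]]) auto
qed

lemma integrable_total_cover_time:
  assumes "finite V"
  shows "integrable (kernel_alpha_rounding \<beta> V x) (\<lambda>\<sigma>. real (total_cover_time E \<sigma>))"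
proof -
  interpret prob_space "kernel_alpha_rounding \<beta> V x"
    by (rule prob_space_kernel_alpha_rounding[OF assms])
  let ?B = "Max (total_cover_time E ` orderings V)"
  show ?thesis
  proof (rule integrable_const_bound)
    show "AE \<sigma> in kernel_alpha_rounding \<beta> V x. norm (real (total_cover_time E \<sigma>)) \<le> real ?B"
      using AE_kernel_alpha_rounding_orderings[OF assms]
      by eventually_elim (use finite_orderings[OF assms] in auto)
    show "(\<lambda>\<sigma>. real (total_cover_time E \<sigma>)) \<in> borel_measurable (kernel_alpha_rounding \<beta> V x)"
      by (rule measurableI) (use sets_eq_imp_space_eq[of "kernel_alpha_rounding \<beta> V x"
            "count_space UNIV"] in \<open>auto simp: sets_kernel_alpha_rounding\<close>)
  qed
qed

lemma lp_optimal_exists: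
  fixes V :: "'v set"
  assumes "mssc_instance V E"
  shows "\<exists>x u. lp_optimal V E x u"
proof -
  have finV: "finite V" and EV: "E \<subseteq> Pow V"
    using assms by (auto simp: mssc_instance_def)
  let ?n = "card V"
  let ?slack = "\<lambda>(y :: 'v \<times> nat \<Rightarrow> real) e t. max 0 (1 - (\<Sum>v\<in>e. \<Sum>t'\<in>{1..<t}. y (v, t')))"
  let ?f = "\<lambda>y. \<Sum>e\<in>E. \<Sum>t\<in>{1..?n}. ?slack y e t"
  let ?K = "PiE UNIV (\<lambda>_ :: 'v \<times> nat. {0..1::real})"
  let ?C = "\<Inter>t\<in>{1..?n}. {y :: 'v \<times> nat \<Rightarrow> real. (\<Sum>v\<in>V. y (v, t)) \<le> 1}"
  have cont: "continuous_on S (\<lambda>y :: 'v \<times> nat \<Rightarrow> real. y p)" for S p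
    by (rule continuous_on_subset[OF continuous_on_product_coordinates]) auto
  have "compactin (product_topology (\<lambda>_. euclidean) UNIV) ?K"
    by (subst compactin_PiE) auto
  then have "compact ?K"
    by (simp add: euclidean_product_topology compactin_euclidean_iff)
  moreover have "closed ?C"
    by (intro closed_INT ballI closed_Collect_le continuous_intros cont)
  ultimately have "compact (?K \<inter> ?C)" by (rule compact_Int_closed)
  moreover have "(\<lambda>_. 0) \<in> ?K \<inter> ?C" by auto
  then have "?K \<inter> ?C \<noteq> {}" by blast
  moreover have "continuous_on (?K \<inter> ?C) ?f"
    by (intro continuous_intros cont)
  ultimately have "\<exists>y \<in> ?K \<inter> ?C. \<forall>y' \<in> ?K \<inter> ?C. ?f y \<le> ?f y'"
    by (rule continuous_attains_inf)
  then obtain y where y: "y \<in> ?K \<inter> ?C" and ymin: "\<forall>y' \<in> ?K \<inter> ?C. ?f y \<le> ?f y'"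
    by (rule bexE)
  have "lp_feasible V E (\<lambda>v t. y (v, t)) (?slack y)"
    using y by (force simp: lp_feasible_def PiE_def Pi_def)
  moreover have "lp_value V E (?slack y) \<le> lp_value V E u'" if feas: "lp_feasible V E x' u'" for x' u'
  proof -
    define y' where "y' = (\<lambda>(v, t). if v \<in> V \<and> t \<in> {1..?n} then x' v t else 0)"
    have "x' v t \<le> 1" if "v \<in> V" "t \<in> {1..?n}" for v t
    proof -
      have "x' v t \<le> (\<Sum>v\<in>V. x' v t)"
        using feas that finV by (intro member_le_sum) (auto simp: lp_feasible_def)
      also have "\<dots> \<le> 1" using feas that by (auto simp: lp_feasible_def)
      finally show ?thesis .
    qed
    then have "y' \<in> ?K"
      using feas by (auto simp: y'_def lp_feasible_def)
    moreover have "y' \<in> ?C"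
      using feas by (auto simp: y'_def lp_feasible_def)
    ultimately have "y' \<in> ?K \<inter> ?C" by (rule IntI)
    with ymin have "?f y \<le> ?f y'" by (rule bspec)
    also have "\<dots> \<le> lp_value V E u'"
      unfolding lp_value_def
    proof (intro sum_mono)
      fix e t assume e: "e \<in> E" and t: "t \<in> {1..?n}"
      have "(\<Sum>v\<in>e. \<Sum>t'\<in>{1..<t}. y' (v, t')) = (\<Sum>v\<in>e. \<Sum>t'\<in>{1..<t}. x' v t')"
        using e t EV by (intro sum.cong refl) (auto simp: y'_def)
      moreover have "0 \<le> u' e t" "u' e t + (\<Sum>v\<in>e. \<Sum>t'\<in>{1..<t}. x' v t') \<ge> 1"
        using feas e t unfolding lp_feasible_def by blast+
      ultimately show "?slack y' e t \<le> u' e t" by simp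
    qed
    finally show ?thesis by (simp add: lp_value_def)
  qed
  ultimately show ?thesis unfolding lp_optimal_def by blast
qed

end

theory Submission
  imports Defs
begin

text \<open>
  Write \<open>n = |V|\<close>. Fix an edge \<open>e\<close>, let \<open>T\<close> be the minimum of \<open>\<tau>\<close> over \<open>e\<close>, \<open>F t = P(T > t)\<close>, and
  \<open>y t\<close> the LP mass placed on \<open>e\<close> up to time \<open>t\<close>. However ties are broken, only vertices
  \<open>w \<notin> e\<close> with \<open>\<tau> w \<le> T\<close> can precede all of \<open>e\<close>; these are independent of \<open>T\<close> and at most
  \<open>\<beta> t\<close> of them are expected by time \<open>t\<close>, since the kernel mass per time step is at most \<open>\<beta>\<close>.
  Using the trivial bound \<open>n\<close> when \<open>T > n\<close>, summation by parts bounds the expected cover time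
  by \<open>1 + \<beta> (\<Sum>t<n. F t)\<close>. Moreover \<open>F t \<le> G t = exp (- (\<Sum>s=1..t. \<beta> y s / s))\<close>, and induction
  on \<open>m\<close> yields
  \<open>\<beta> (\<beta> - 1) (\<Sum>t\<le>m. G t) + (\<beta> m + 1) G m + (\<beta> - 1) \<le> \<beta>\<^sup>2 (\<Sum>t\<le>m. max 0 (1 - y t))\<close>.
  For \<open>m = n - 1\<close> the right-hand sum is at most the LP cost of \<open>e\<close>. The middle term makes the
  induction work: by convexity of \<open>exp\<close> the step reduces to the endpoints \<open>y = 0\<close>, where it is
  immediate, and \<open>y = 1\<close>, where it reads \<open>1 + \<beta>\<^sup>2 / (\<beta> (m - 1) + 1) \<le> exp (\<beta> / m)\<close>.
\<close>

section \<open>The exponential inequality for the kernel mass\<close>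

lemma exp_ge_cubic_Taylor:
  fixes h :: real
  assumes "0 \<le> h"
  shows "1 + h + h\<^sup>2 / 2 + h ^ 3 / 6 \<le> exp h"
proof -
  have "(\<Sum>k<4. h ^ k /\<^sub>R fact k) \<le> (\<Sum>k. h ^ k /\<^sub>R fact k)"
    using assms by (intro sum_le_suminf summable_exp_generic) auto
  then show ?thesis
    by (simp add: exp_def eval_nat_numeral fact_numeral field_simps)
qed

text \<open>The endpoint \<open>y = 1\<close> of the induction step, with
  \<open>h = \<beta> / n\<close>. The quadratic Taylor polynomial of \<open>exp\<close> is too weak:
  for \<open>n = 1\<close> it suffices only up to \<open>\<beta> = 2\<close>. The cubic one works
  for all \<open>\<beta> > 1\<close>.\<close>

lemma kernel_ratio_le_exp:
  fixes \<beta> h n :: real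
  assumes "1 < \<beta>" "1 \<le> n" and h: "\<beta> = h * n"
  shows "\<beta> * (n - 1) + 1 + \<beta>\<^sup>2 \<le> (\<beta> * (n - 1) + 1) * exp h"
proof -
  have "0 < h * n" using assms by simp
  then have "0 < h" using assms(2) by (simp add: zero_less_mult_iff)
  then have "h \<le> \<beta>" using assms(2) by (simp add: h)
  \<comment> \<open>With \<open>exp h\<close> replaced by the cubic and \<open>n\<close> eliminated,
    dividing by \<open>h\<close> leaves \<open>h / 6 * (h * (\<beta> - 1))\<close> as the only term
    quadratic in \<open>h\<close>. Using \<open>h \<le> \<beta>\<close> once there makes everything
    affine in \<open>h\<close>, so the sign of the slope decides whether to compare with
    \<open>h = 0\<close> or \<open>h = \<beta>\<close>; either leaves a quadratic in \<beta> without
    real roots.\<close>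
  have "0 \<le> 1 - \<beta> + \<beta>\<^sup>2 / 2 + h / 2 * (1 - 2 * \<beta> / 3)"
  proof (cases "2 * \<beta> / 3 \<le> 1")
    case True
    then have "0 \<le> h / 2 * (1 - 2 * \<beta> / 3)" using \<open>0 < h\<close> by simp
    moreover have "0 \<le> (1 - \<beta>)\<^sup>2" by simp
    ultimately show ?thesis by (simp add: power2_eq_square algebra_simps)
  next
    case False
    then have "\<beta> / 2 * (1 - 2 * \<beta> / 3) \<le> h / 2 * (1 - 2 * \<beta> / 3)"
      using \<open>h \<le> \<beta>\<close> by (intro mult_right_mono_neg) auto
    moreover have "0 \<le> (\<beta> - 3 / 2)\<^sup>2" by simp
    ultimately show ?thesis by (simp add: power2_eq_square algebra_simps)
  qed
  also have "\<dots> = 1 - \<beta> + \<beta>\<^sup>2 / 2 + h / 2 * (1 - \<beta> + \<beta>\<^sup>2 / 3) - h / 6 * (\<beta> * (\<beta> - 1))"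
    by (simp add: power2_eq_square field_simps)
  also have "\<dots> \<le> 1 - \<beta> + \<beta>\<^sup>2 / 2 + h / 2 * (1 - \<beta> + \<beta>\<^sup>2 / 3) - h / 6 * (h * (\<beta> - 1))"
    using \<open>0 < h\<close> \<open>h \<le> \<beta>\<close> assms(1) by (intro diff_left_mono mult_left_mono mult_right_mono) auto
  finally have "0 \<le> h * \<dots>" using \<open>0 < h\<close> by simp
  also have "\<dots> = (\<beta> * (n - 1) + 1) * (h + h\<^sup>2 / 2 + h ^ 3 / 6) - \<beta>\<^sup>2"
    unfolding h by (simp add: field_simps power2_eq_square power3_eq_cube)
  finally have "\<beta> * (n - 1) + 1 + \<beta>\<^sup>2 \<le> (\<beta> * (n - 1) + 1) * (1 + h + h\<^sup>2 / 2 + h ^ 3 / 6)"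
    by (simp add: algebra_simps)
  also have "\<dots> \<le> (\<beta> * (n - 1) + 1) * exp h"
    using \<open>0 < h\<close> assms by (intro mult_left_mono exp_ge_cubic_Taylor) auto
  finally show ?thesis .
qed

lemma kernel_step:
  fixes \<beta> y n :: real
  assumes "1 < \<beta>" "1 \<le> n" "0 \<le> y"
  shows "(\<beta> * (n - 1) + 1 + \<beta>\<^sup>2) * exp (- (\<beta> / n * y)) \<le> \<beta> * (n - 1) + 1 + \<beta>\<^sup>2 * max 0 (1 - y)"
proof -
  \<comment> \<open>\<open>b\<close> is the coefficient of \<open>G\<close> before the step. Beyond
    \<open>y = 1\<close> the right-hand side is constant while the left-hand side decreases, so
    \<open>y\<close> is truncated to \<open>p\<close>.\<close>
  define h p b where "h = \<beta> / n" and "p = min y 1" and "b = \<beta> * (n - 1) + 1"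
  have "0 < h" "0 \<le> p" "p \<le> 1" "p \<le> y" using assms by (auto simp: h_def p_def)
  have "0 < b" using assms by (simp add: b_def add_nonneg_pos)
  have "b + \<beta>\<^sup>2 \<le> b * exp h"
    unfolding b_def using assms by (intro kernel_ratio_le_exp) (auto simp: h_def)
  then have "(b + \<beta>\<^sup>2) * exp (- h) \<le> b * exp h * exp (- h)"
    by (intro mult_right_mono) auto
  then have last: "(b + \<beta>\<^sup>2) * exp (- h) \<le> b"
    by (simp add: mult.assoc flip: exp_add)
  have "exp (- (h * y)) \<le> exp (- (h * p))"
    using \<open>0 < h\<close> \<open>p \<le> y\<close> by simp
  \<comment> \<open>The chord of \<open>exp\<close> between \<open>- h\<close> and
    \<open>0\<close>.\<close>
  also have "\<dots> \<le> (1 - p) * exp 0 + p * exp (- h)"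
    using convex_onD[OF exp_convex, of p 0 "- h"] \<open>0 \<le> p\<close> \<open>p \<le> 1\<close> by (simp add: mult.commute)
  finally have "(b + \<beta>\<^sup>2) * exp (- (h * y)) \<le> (b + \<beta>\<^sup>2) * ((1 - p) + p * exp (- h))"
    using \<open>0 < b\<close> by (intro mult_left_mono) auto
  also have "\<dots> = (b + \<beta>\<^sup>2) * (1 - p) + p * ((b + \<beta>\<^sup>2) * exp (- h))"
    by (simp add: algebra_simps)
  also have "\<dots> \<le> (b + \<beta>\<^sup>2) * (1 - p) + p * b"
    using \<open>0 \<le> p\<close> last by (intro add_left_mono mult_left_mono)
  also have "\<dots> = b + \<beta>\<^sup>2 * max 0 (1 - y)"
    by (simp add: p_def max_def min_def algebra_simps)
  finally show ?thesis by (simp add: b_def h_def)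
qed

lemma sum_exp_kernel_le:
  fixes \<beta> :: real and y :: "nat \<Rightarrow> real"
  assumes "1 < \<beta>" and nonneg: "\<And>t. 0 \<le> y t" and "y 0 = 0"
  defines "G \<equiv> \<lambda>t. exp (- (\<Sum>s=1..t. \<beta> / real s * y s))"
  shows "\<beta> * (\<beta> - 1) * (\<Sum>t\<le>m. G t) + (\<beta> * real m + 1) * G m + (\<beta> - 1)
    \<le> \<beta>\<^sup>2 * (\<Sum>t\<le>m. max 0 (1 - y t))"
proof (induction m)
  case 0
  \<comment> \<open>Both sides equal \<open>\<beta>\<^sup>2\<close>. This fixes the constant
    \<open>\<beta> - 1\<close>, which later pays for the summand 1 in the bound on the expected
    cover time.\<close>
  then show ?case using assms by (simp add: power2_eq_square algebra_simps)
next
  case (Suc m)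
  define w where "w = exp (- (\<beta> / real (Suc m) * y (Suc m)))"
  \<comment> \<open>The left-hand side grows by \<open>G m * d\<close>, because the two coefficients
    of \<open>G (Suc m)\<close> add up to
    \<open>\<beta> * real m + 1 + \<beta>\<^sup>2\<close>.\<close>
  define d where "d = (\<beta> * real m + 1 + \<beta>\<^sup>2) * w - (\<beta> * real m + 1)"
  have G: "G (Suc m) = G m * w"
    by (simp add: G_def w_def flip: exp_add)
  have "G m \<le> 1" "0 \<le> G m"
    using nonneg assms(1) by (auto simp: G_def intro!: sum_nonneg)
  have "d \<le> \<beta>\<^sup>2 * max 0 (1 - y (Suc m))"
    using kernel_step[of \<beta> "real (Suc m)" "y (Suc m)"] assms(1) nonneg by (simp add: w_def d_def)
  then have "G m * d \<le> G m * (\<beta>\<^sup>2 * max 0 (1 - y (Suc m)))"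
    using \<open>0 \<le> G m\<close> by (intro mult_left_mono)
  also have "\<dots> \<le> 1 * (\<beta>\<^sup>2 * max 0 (1 - y (Suc m)))"
    using \<open>G m \<le> 1\<close> by (intro mult_right_mono) auto
  finally have *: "G m * d \<le> \<beta>\<^sup>2 * max 0 (1 - y (Suc m))" by simp
  have "\<beta> * (\<beta> - 1) * (\<Sum>t\<le>Suc m. G t) + (\<beta> * real (Suc m) + 1) * G (Suc m) + (\<beta> - 1)
    = (\<beta> * (\<beta> - 1) * (\<Sum>t\<le>m. G t) + (\<beta> * real m + 1) * G m + (\<beta> - 1)) + G m * d"
    by (simp add: G d_def algebra_simps power2_eq_square)
  also have "\<dots> \<le> \<beta>\<^sup>2 * (\<Sum>t\<le>m. max 0 (1 - y t)) + \<beta>\<^sup>2 * max 0 (1 - y (Suc m))"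
    using Suc.IH * by (rule add_mono)
  finally show ?case by (simp add: distrib_left)
qed

section \<open>The LP value as a lower bound on the optimum\<close>

lemma lp_value_le_mssc_opt:
  assumes inst: "mssc_instance V E" and opt: "lp_optimal V E x u"
  shows "lp_value V E u \<le> real (mssc_opt V E)"
proof -
  have finV: "finite V" and EV: "E \<subseteq> Pow V" and ne: "{} \<notin> E"
    using inst by (auto simp: mssc_instance_def)
  have "orderings V \<noteq> {}"
    using sorted_orderings_nonempty[OF finV, of "\<lambda>_. 0"] by (auto simp: sorted_orderings_def)
  then have "mssc_opt V E \<in> total_cover_time E ` orderings V"
    unfolding mssc_opt_def using finite_orderings[OF finV] by (intro Min_in) auto
  then obtain \<sigma> where \<sigma>: "\<sigma> \<in> orderings V" and eq: "mssc_opt V E = total_cover_time E \<sigma>"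
    by auto
  have bij: "bij_betw \<sigma> V {1..card V}" using \<sigma> by (simp add: orderings_def)
  \<comment> \<open>An optimal ordering becomes an integral LP solution. The LP counts only mass
    strictly before \<open>t\<close>, so \<open>u'\<close> is still 1 at the cover time
    itself.\<close>
  define x' where "x' = (\<lambda>v t. if \<sigma> v = t then 1 else 0 :: real)"
  define u' where "u' = (\<lambda>e t. if t \<le> cover_time \<sigma> e then 1 else 0 :: real)"
  have "lp_feasible V E x' u'"
    unfolding lp_feasible_def
  proof (intro conjI ballI)
    fix t assume t: "t \<in> {1..card V}"
    have "(\<Sum>v\<in>V. x' v t) = real (card {v \<in> V. \<sigma> v = t})"
      using finV by (simp add: x'_def sum.If_cases Int_def)
    also have "card {v \<in> V. \<sigma> v = t} \<le> card {the_inv_into V \<sigma> t}"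
      using bij by (intro card_mono) (auto simp: bij_betw_def the_inv_into_f_f)
    finally show "(\<Sum>v\<in>V. x' v t) \<le> 1" by simp
  next
    fix e t assume e: "e \<in> E" and t: "t \<in> {1..card V}"
    have fe: "finite e" "e \<noteq> {}" "e \<subseteq> V"
      using e EV ne finV by (auto intro: finite_subset)
    have nonneg: "0 \<le> (\<Sum>v\<in>e. \<Sum>t'\<in>{1..<t}. x' v t')"
      by (intro sum_nonneg) (simp add: x'_def)
    show "1 \<le> u' e t + (\<Sum>v\<in>e. \<Sum>t'\<in>{1..<t}. x' v t')"
    proof (cases "t \<le> cover_time \<sigma> e")
      case True
      then show ?thesis using nonneg by (simp add: u'_def)
    next
      case False
      have "cover_time \<sigma> e \<in> \<sigma> ` e" unfolding cover_time_def using fe by (intro Min_in) auto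
      then obtain v where v: "v \<in> e" "\<sigma> v = cover_time \<sigma> e" by auto
      have "\<sigma> v \<in> {1..<t}"
        using bij_betwE[OF bij] v(1) fe(3) v(2)[symmetric] False by auto
      then have "1 \<le> (\<Sum>t'\<in>{1..<t}. x' v t')"
        by (simp add: x'_def)
      also have "\<dots> \<le> (\<Sum>v\<in>e. \<Sum>t'\<in>{1..<t}. x' v t')"
        by (rule member_le_sum[OF v(1)]) (auto simp: x'_def fe intro!: sum_nonneg)
      finally show ?thesis using False by (simp add: u'_def)
    qed
  qed (auto simp: x'_def u'_def)
  then have "lp_value V E u \<le> lp_value V E u'"
    using opt by (auto simp: lp_optimal_def)
  also have "\<dots> = (\<Sum>e\<in>E. real (card ({1..card V} \<inter> {t. t \<le> cover_time \<sigma> e})))"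
    by (simp add: lp_value_def u'_def sum.If_cases)
  also have "\<dots> \<le> (\<Sum>e\<in>E. real (card {1..cover_time \<sigma> e}))"
    by (intro sum_mono of_nat_mono card_mono) auto
  also have "\<dots> = real (mssc_opt V E)"
    by (simp add: eq total_cover_time_def)
  finally show ?thesis .
qed

section \<open>Cover times of orderings sorted by \<tau>\<close>

lemma cover_time_le_card:
  assumes "\<sigma> \<in> orderings V" "finite V" "e \<subseteq> V" "e \<noteq> {}"
  shows "cover_time \<sigma> e \<le> card V"
proof -
  have "cover_time \<sigma> e \<in> \<sigma> ` e"
    unfolding cover_time_def using assms by (intro Min_in) (auto intro: finite_subset)
  then show ?thesis using assms by (fastforce simp: orderings_def bij_betw_def)
qed

text \<open>Every position before the cover time holds a vertex outside \<open>e\<close>, and one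
  with key above \<open>\<tau> v\<close> would come after \<open>v\<close>. Counting all ties
  against \<open>e\<close> covers every way of breaking them.\<close>

lemma cover_time_sorted_le:
  assumes \<sigma>: "\<sigma> \<in> sorted_orderings V \<tau>" and finV: "finite V" and e: "e \<subseteq> V"
    and v: "v \<in> e"
  shows "cover_time \<sigma> e \<le> 1 + card {w \<in> V - e. \<tau> w \<le> \<tau> v}"
proof -
  let ?c = "cover_time \<sigma> e"
  have fe: "finite e" using e finV by (rule finite_subset)
  have bij: "bij_betw \<sigma> V {1..card V}" using \<sigma> by (simp add: sorted_orderings_def orderings_def)
  have c: "?c \<le> \<sigma> w" if "w \<in> e" for w
    unfolding cover_time_def using fe that by auto
  have "?c \<le> card V"
    using \<sigma> finV e v by (intro cover_time_le_card) (auto simp: sorted_orderings_def)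
  have "{1..<?c} \<subseteq> \<sigma> ` {w \<in> V - e. \<tau> w \<le> \<tau> v}"
  proof
    fix i assume i: "i \<in> {1..<?c}"
    then have "i \<in> \<sigma> ` V" using bij \<open>?c \<le> card V\<close> by (auto simp: bij_betw_def)
    then obtain w where w: "w \<in> V" "i = \<sigma> w" by auto
    then have "w \<notin> e" using c i by fastforce
    moreover have "\<tau> w \<le> \<tau> v"
    proof (rule ccontr)
      assume "\<not> \<tau> w \<le> \<tau> v"
      then have "\<sigma> v < \<sigma> w" using \<sigma> w(1) v e by (auto simp: sorted_orderings_def)
      then show False using c[OF v] i w(2) by simp
    qed
    ultimately show "i \<in> \<sigma> ` {w \<in> V - e. \<tau> w \<le> \<tau> v}" using w by blast
  qed
  then have "card {1..<?c} \<le> card {w \<in> V - e. \<tau> w \<le> \<tau> v}"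
    using finV by (intro surj_card_le) auto
  then show ?thesis by simp
qed

text \<open>The difference \<open>g (t - 1) - g t\<close> indicates that the minimum of \<tau> over
  \<open>e\<close> is \<open>t\<close>, and \<open>g (card V)\<close> that it exceeds the horizon.
  In this form the bound is linear in products of an event about \<open>e\<close> and an event about
  one vertex outside it, so expectations factor.\<close>

lemma cover_time_le_indicator_sum:
  fixes \<tau> :: "'v \<Rightarrow> enat"
  assumes \<sigma>: "\<sigma> \<in> sorted_orderings V \<tau>" and finV: "finite V" and e: "e \<subseteq> V" "e \<noteq> {}"
    and pos: "\<And>v. v \<in> V \<Longrightarrow> 0 < \<tau> v"
  defines "g \<equiv> \<lambda>t. of_bool (\<forall>v\<in>e. enat t < \<tau> v) :: real"
  shows "real (cover_time \<sigma> e) \<le>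
    (\<Sum>t=1..card V. (g (t - 1) - g t) * (1 + (\<Sum>w\<in>V - e. of_bool (\<tau> w \<le> enat t))))
      + real (card V) * g (card V)" (is "_ \<le> ?R")
proof (cases "g (card V) = 1")
  case True
  have "g t = 1" if "t \<le> card V" for t
  proof -
    have "enat t \<le> enat (card V)" using that by simp
    then show ?thesis using True le_less_trans unfolding g_def by (simp only: of_bool_eq_1_iff) blast
  qed
  then have "?R = (\<Sum>t=1..card V. 0) + real (card V)"
    by (intro arg_cong2[where f = "(+)"] sum.cong) auto
  then have "?R = real (card V)" by simp
  then show ?thesis
    using cover_time_le_card[of \<sigma> V e] \<sigma> finV e by (simp add: sorted_orderings_def)
next
  case False
  have fe: "finite e" using e finV by (auto intro: finite_subset)
  obtain v where v: "v \<in> e" "\<And>w. w \<in> e \<Longrightarrow> \<tau> v \<le> \<tau> w"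
    using Min_in[of "\<tau> ` e"] Min_le[of "\<tau> ` e"] fe e(2) by fastforce
  have g: "g t = of_bool (enat t < \<tau> v)" for t
    using v by (auto simp: g_def intro: less_le_trans)
  have "\<tau> v \<le> enat (card V)" using False by (simp add: g not_less)
  then obtain k where k: "\<tau> v = enat k" "k \<le> card V"
    by (cases "\<tau> v") auto
  \<comment> \<open>The sum starts at \<open>t = 1\<close> and would miss a minimum of 0, which
    \<open>pos\<close> excludes.\<close>
  have "1 \<le> k" using pos[of v] v(1) e(1) k by (cases k) (auto simp: zero_enat_def)
  have "?R = (\<Sum>t=1..card V. if t = k then 1 + (\<Sum>w\<in>V - e. of_bool (\<tau> w \<le> enat t)) else 0)"
  proof -
    have "g (t - 1) - g t = of_bool (t = k)" if "1 \<le> t" for t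
      using that by (auto simp: g k)
    moreover have "g (card V) = 0" using k by (simp add: g)
    ultimately show ?thesis by (auto intro!: sum.cong)
  qed
  also have "\<dots> = 1 + (\<Sum>w\<in>V - e. of_bool (\<tau> w \<le> \<tau> v))"
    using k \<open>1 \<le> k\<close> by simp
  also have "\<dots> = real (1 + card {w \<in> V - e. \<tau> w \<le> \<tau> v})"
    using finV by (simp add: Int_def)
  finally show ?thesis
    using cover_time_sorted_le[OF \<sigma> finV e(1) v(1)] by linarith
qed

section \<open>Probabilities and integrals over the random thresholds\<close>

lemma has_bochner_integral_prod_indicator_PiM:
  fixes M :: "'a measure"
  assumes M: "prob_space M" and finV: "finite V" and e: "e \<subseteq> V"
    and A: "\<And>v. v \<in> e \<Longrightarrow> A v \<in> sets M"
  shows "has_bochner_integral (PiM V (\<lambda>_. M)) (\<lambda>\<alpha>. \<Prod>v\<in>e. indicator (A v) (\<alpha> v))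
    (\<Prod>v\<in>e. measure M (A v))"
proof -
  interpret M: prob_space M by (rule M)
  interpret product_prob_space "\<lambda>_. M" V
    by unfold_locales
  \<comment> \<open>Padding with the whole space, of measure 1, turns the product over
    \<open>e\<close> into one over all of \<open>V\<close>.\<close>
  define A' where "A' = (\<lambda>v. if v \<in> e then A v else space M)"
  have A': "A' v \<in> sets M" for v using A by (simp add: A'_def)
  have int: "integrable M (indicator (A' v) :: _ \<Rightarrow> real)" for v
    using A' M.emeasure_finite[of "A' v"]
    by (simp add: integrable_indicator_iff sets.Int_space_eq2 less_top[symmetric])
  have "has_bochner_integral (PiM V (\<lambda>_. M)) (\<lambda>\<alpha>. \<Prod>v\<in>V. indicator (A' v) (\<alpha> v))
    (\<Prod>v\<in>V. measure M (A' v))"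
    using product_integrable_prod[OF finV, of "\<lambda>v. indicator (A' v) :: _ \<Rightarrow> real"]
      product_integral_prod[OF finV, of "\<lambda>v. indicator (A' v) :: _ \<Rightarrow> real"] int A'
    by (simp add: has_bochner_integral_iff sets.Int_space_eq2)
  also have "(\<Prod>v\<in>V. measure M (A' v)) = (\<Prod>v\<in>e. measure M (A v))"
    using finV e by (intro prod.mono_neutral_cong_right) (auto simp: A'_def M.prob_space)
  finally show ?thesis
  proof (rule has_bochner_integral_cong[THEN iffD1, rotated -1])
    fix \<alpha> assume \<alpha>: "\<alpha> \<in> space (PiM V (\<lambda>_. M))"
    show "(\<Prod>v\<in>V. indicator (A' v) (\<alpha> v)) = (\<Prod>v\<in>e. indicator (A v) (\<alpha> v))"
    proof (rule prod.mono_neutral_cong_right[OF finV e])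
      have "\<alpha> v \<in> space M" if "v \<in> V" for v
        using \<alpha> that by (auto simp: space_PiM dest: PiE_mem)
      then show "\<forall>v\<in>V - e. indicator (A' v) (\<alpha> v) = 1"
        by (simp add: A'_def)
    qed (simp add: A'_def)
  qed auto
qed

lemma prob_space_uniform_unit: "prob_space (uniform_measure lborel {0..1::real})"
  by (intro prob_space_uniform_measure) auto

lemma measure_uniform_unit_greaterThan_le_exp:
  assumes "0 \<le> c"
  shows "measure (uniform_measure lborel {0..1::real}) {c<..} \<le> exp (- c)"
proof -
  have "{0..1} \<inter> {c<..} = {c<..1}" using assms by auto
  then have "measure (uniform_measure lborel {0..1::real}) {c<..} = max 0 (1 - c)"
    by (simp add: measure_uniform_measure measure_lborel_Ioc max_def)
  then show ?thesis using exp_ge_add_one_self[of "- c"] by simp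
qed

lemma measure_uniform_unit_atMost_le:
  assumes "0 \<le> c"
  shows "measure (uniform_measure lborel {0..1::real}) {..c} \<le> c"
proof -
  have "{0..1} \<inter> {..c} = {0..min 1 c}" by auto
  then show ?thesis using assms by (simp add: measure_uniform_measure)
qed

lemma alpha_point_pos: "0 < alpha_point z a"
proof (cases "\<exists>t\<ge>1. (\<Sum>t'\<in>{1..t}. z t') \<ge> a")
  case True
  then show ?thesis
    using LeastI_ex[of "\<lambda>t. 1 \<le> t \<and> (\<Sum>t'\<in>{1..t}. z t') \<ge> a"]
    by (auto simp: alpha_point_def zero_enat_def)
next
  case False
  then have "alpha_point z a = \<infinity>" unfolding alpha_point_def by (rule if_not_P)
  then show ?thesis by simp
qed

text \<open>Nonnegativity makes partial sums monotone, so the times that reach \<open>a\<close> are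
  upward closed. At \<open>t = 0\<close> the equivalence fails for \<open>a = 0\<close>, since
  \<alpha>-points are always positive.\<close>

lemma enat_less_alpha_point_iff:
  assumes "\<And>t. 0 \<le> z t" and "1 \<le> t"
  shows "enat t < alpha_point z a \<longleftrightarrow> (\<Sum>s=1..t. z s) < a"
proof -
  let ?P = "\<lambda>t. 1 \<le> t \<and> (\<Sum>s=1..t. z s) \<ge> a"
  have mono: "(\<Sum>s=1..i. z s) \<le> (\<Sum>s=1..j. z s)" if "i \<le> j" for i j
    using that assms(1) by (intro sum_mono2) auto
  show ?thesis
  proof (cases "\<exists>t. ?P t")
    case True
    then have "?P (Least ?P)" by (rule LeastI_ex)
    moreover have "alpha_point z a = enat (Least ?P)"
      using True by (simp add: alpha_point_def)
    moreover have "Least ?P \<le> t" if "a \<le> (\<Sum>s=1..t. z s)"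
      using that \<open>1 \<le> t\<close> by (intro Least_le) simp
    moreover have "a \<le> (\<Sum>s=1..t. z s)" if "Least ?P \<le> t"
      using mono[OF that] calculation(1) by linarith
    ultimately have "alpha_point z a \<le> enat t \<longleftrightarrow> a \<le> (\<Sum>s=1..t. z s)" by auto
    then show ?thesis by (simp add: not_le[symmetric])
  next
    case False
    then have "alpha_point z a = \<infinity>" unfolding alpha_point_def by (intro if_not_P) simp
    moreover have "(\<Sum>s=1..t. z s) < a" using False \<open>1 \<le> t\<close> by (meson not_le)
    ultimately show ?thesis by simp
  qed
qed

lemma measure_alpha_point_greater_le:
  assumes "\<And>t. 0 \<le> z t"
  shows "measure (uniform_measure lborel {0..1}) {a. enat t < alpha_point z a} \<le> exp (- (\<Sum>s=1..t. z s))"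
proof (cases "1 \<le> t")
  case True
  then have "{a. enat t < alpha_point z a} = {(\<Sum>s=1..t. z s)<..}"
    using enat_less_alpha_point_iff[OF assms] by auto
  then show ?thesis
    using measure_uniform_unit_greaterThan_le_exp assms by (simp add: sum_nonneg)
next
  case False
  \<comment> \<open>At \<open>t = 0\<close> the sum is empty and the bound is the trivial 1.\<close>
  then have "exp (- (\<Sum>s=1..t. z s)) = 1" by simp
  then show ?thesis using prob_space.prob_le_1[OF prob_space_uniform_unit] by (simp only:)
qed

lemma measure_alpha_point_le_le:
  assumes "\<And>t. 0 \<le> z t" "1 \<le> t"
  shows "measure (uniform_measure lborel {0..1}) {a. alpha_point z a \<le> enat t} \<le> (\<Sum>s=1..t. z s)"
proof -
  have "{a. alpha_point z a \<le> enat t} = {..(\<Sum>s=1..t. z s)}"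
    using enat_less_alpha_point_iff[OF assms] by (auto simp: not_less[symmetric])
  then show ?thesis
    using measure_uniform_unit_atMost_le assms by (simp add: sum_nonneg)
qed

text \<open>A bound valid for every compatible ordering survives averaging over the tie-breaks.
  Nonnegative integrals carry it through the bind without integrability of \<open>f\<close>.\<close>

lemma integral_kernel_alpha_rounding_le:
  fixes f :: "('v \<Rightarrow> nat) \<Rightarrow> real"
  assumes finV: "finite V" and "\<And>\<sigma>. 0 \<le> f \<sigma>"
    and R: "integrable (\<Pi>\<^sub>M v\<in>V. uniform_measure lborel {0..1}) R"
    and le: "\<And>\<alpha> \<sigma>. \<sigma> \<in> sorted_orderings V (\<lambda>v. alpha_point (kernel_z \<beta> (card V) (x v)) (\<alpha> v))
      \<Longrightarrow> f \<sigma> \<le> R \<alpha>"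
  shows "(\<integral>\<sigma>. f \<sigma> \<partial>kernel_alpha_rounding \<beta> V x)
    \<le> (\<integral>\<alpha>. R \<alpha> \<partial>(\<Pi>\<^sub>M v\<in>V. uniform_measure lborel {0..1}))"
proof -
  let ?M = "\<Pi>\<^sub>M v\<in>V. uniform_measure lborel {0..1::real}"
  let ?S = "\<lambda>\<alpha>. sorted_orderings V (\<lambda>v. alpha_point (kernel_z \<beta> (card V) (x v)) (\<alpha> v))"
  have S: "finite (?S \<alpha>)" "?S \<alpha> \<noteq> {}" for \<alpha>
    using finite_orderings[OF finV] sorted_orderings_nonempty[OF finV]
    by (auto simp: sorted_orderings_def intro: finite_subset)
  \<comment> \<open>Some compatible ordering always exists, so \<open>R\<close> inherits
    nonnegativity from \<open>f\<close>.\<close>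
  have R0: "0 \<le> R \<alpha>" for \<alpha>
    using S(2)[of \<alpha>] le[of _ \<alpha>] assms(2) order_trans by blast
  have "(\<integral>\<^sup>+\<sigma>. ennreal (f \<sigma>) \<partial>kernel_alpha_rounding \<beta> V x)
    = (\<integral>\<^sup>+\<alpha>. (\<integral>\<^sup>+\<sigma>. ennreal (f \<sigma>) \<partial>measure_pmf (pmf_of_set (?S \<alpha>))) \<partial>?M)"
    unfolding kernel_alpha_rounding_def
    by (rule nn_integral_bind[OF _ measurable_rounding_kernel[OF finV]]) simp
  also have "\<dots> \<le> (\<integral>\<^sup>+\<alpha>. ennreal (R \<alpha>) \<partial>?M)"
  proof (intro nn_integral_mono)
    fix \<alpha>
    have "(\<integral>\<^sup>+\<sigma>. ennreal (f \<sigma>) \<partial>measure_pmf (pmf_of_set (?S \<alpha>)))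
      \<le> (\<integral>\<^sup>+\<sigma>. ennreal (R \<alpha>) \<partial>measure_pmf (pmf_of_set (?S \<alpha>)))"
      using S[of \<alpha>] le by (intro nn_integral_mono_AE) (auto simp: AE_measure_pmf_iff intro!: ennreal_leI)
    then show "(\<integral>\<^sup>+\<sigma>. ennreal (f \<sigma>) \<partial>measure_pmf (pmf_of_set (?S \<alpha>))) \<le> ennreal (R \<alpha>)"
      by simp
  qed
  also have "\<dots> = ennreal (\<integral>\<alpha>. R \<alpha> \<partial>?M)"
    using R R0 by (intro nn_integral_eq_integral) auto
  finally show ?thesis
    using R0 by (intro integral_real_bounded) auto
qed

section \<open>Expected cover time of a single edge\<close>

lemma sum_by_parts_affine:
  fixes F :: "nat \<Rightarrow> real"
  shows "(\<Sum>t=1..n. (F (t - 1) - F t) * (1 + \<beta> * real t))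
    = F 0 - F n + \<beta> * ((\<Sum>t<n. F t) - real n * F n)"
  by (induction n) (auto simp: algebra_simps)

lemma integral_cover_time_le:
  fixes V :: "'v set"
  assumes inst: "mssc_instance V E" and feas: "lp_feasible V E x u" and "e \<in> E" and "1 < \<beta>"
  shows "(\<integral>\<sigma>. real (cover_time \<sigma> e) \<partial>kernel_alpha_rounding \<beta> V x)
    \<le> \<beta>\<^sup>2 / (\<beta> - 1) * (\<Sum>t=1..card V. u e t)"
proof -
  define n where "n = card V"
  define X where "X = (\<lambda>v. zero_ext n (x v))"
  define z where "z = (\<lambda>v. kernel_z \<beta> n (x v))"
  define y where "y = (\<lambda>t. \<Sum>v\<in>e. \<Sum>s=1..t. X v s)"
  let ?U = "uniform_measure lborel {0..1::real}"
  let ?M = "\<Pi>\<^sub>M v\<in>V. ?U"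
  have finV: "finite V" and e: "e \<subseteq> V" "e \<noteq> {}" "finite e"
    using inst \<open>e \<in> E\<close> by (auto simp: mssc_instance_def intro: finite_subset)
  then have "1 \<le> n" by (auto simp: n_def Suc_le_eq card_gt_0_iff)
  have X0: "0 \<le> X v t" if "v \<in> V" for v t
    using feas that by (auto simp: X_def zero_ext_def lp_feasible_def n_def)
  have z_eq: "z v t = \<beta> / real t * (\<Sum>s=1..t. X v s)" for v t
    by (simp add: z_def kernel_z_def X_def)
  have z0: "0 \<le> z v t" if "v \<in> V" for v t
    unfolding z_eq using X0[OF that] \<open>1 < \<beta>\<close> by (intro mult_nonneg_nonneg sum_nonneg) auto
  define D where "D = (\<lambda>v t. {a. enat t < alpha_point (z v) a})"
  define C where "C = (\<lambda>v t. {a. alpha_point (z v) a \<le> enat t})"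
  \<comment> \<open>By independence of the thresholds, this is the probability that all of
    \<open>e\<close> has \<alpha>-points after \<open>t\<close>.\<close>
  define F where "F = (\<lambda>t. \<Prod>v\<in>e. measure ?U (D v t))"
  define p where "p = (\<lambda>w t. measure ?U (C w t))"
  define g where "g = (\<lambda>t \<alpha>. of_bool (\<forall>v\<in>e. enat t < alpha_point (z v) (\<alpha> v)) :: real)"
  define c where "c = (\<lambda>w t \<alpha>. of_bool (alpha_point (z w) (\<alpha> w) \<le> enat t) :: real)"
  have meas: "{a. P (alpha_point (z v) a)} \<in> sets ?U" for P v
    using measurable_sets[OF measurable_alpha_point, of "{i. P i}" "z v"] by (simp add: vimage_def)
  have g_prod: "g t \<alpha> = (\<Prod>v\<in>e. indicator (D v t) (\<alpha> v))" for t \<alpha>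
    using e(3) unfolding g_def D_def by (induction e rule: finite_induct) (auto simp: indicator_def)
  have int_g: "has_bochner_integral ?M (g t) (F t)" for t
    unfolding g_prod F_def
    by (rule has_bochner_integral_prod_indicator_PiM)
       (use prob_space_uniform_unit finV e meas in \<open>auto simp: D_def\<close>)
  have int_gc: "has_bochner_integral ?M (\<lambda>\<alpha>. g t \<alpha> * c w s \<alpha>) (F t * p w s)"
    if w: "w \<in> V - e" for t s w
  proof -
    \<comment> \<open>As \<open>w\<close> lies outside \<open>e\<close>, it can carry its own event,
      with its own time \<open>s\<close>, in one product over \<open>insert w e\<close>.\<close>
    let ?A = "\<lambda>v. if v = w then C w s else D v t"
    have "has_bochner_integral ?M (\<lambda>\<alpha>. \<Prod>v\<in>insert w e. indicator (?A v) (\<alpha> v))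
        (\<Prod>v\<in>insert w e. measure ?U (?A v))"
      by (rule has_bochner_integral_prod_indicator_PiM)
         (use prob_space_uniform_unit finV e meas w in \<open>auto simp: D_def C_def\<close>)
    moreover have "(\<Prod>v\<in>insert w e. indicator (?A v) (\<alpha> v)) = g t \<alpha> * c w s \<alpha>" for \<alpha>
    proof -
      have "(\<Prod>v\<in>e. indicator (?A v) (\<alpha> v)) = g t \<alpha>"
        unfolding g_prod using w by (intro prod.cong) auto
      then show ?thesis using w e(3) by (simp add: c_def C_def indicator_def mult.commute)
    qed
    moreover have "(\<Prod>v\<in>insert w e. measure ?U (?A v)) = F t * p w s"
    proof -
      have "(\<Prod>v\<in>e. measure ?U (?A v)) = F t"
        unfolding F_def using w by (intro prod.cong) auto
      then show ?thesis using w e(3) by (simp add: p_def mult.commute)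
    qed
    ultimately show ?thesis by simp
  qed
  define R where "R = (\<lambda>\<alpha>. (\<Sum>t=1..n. (g (t - 1) \<alpha> - g t \<alpha>) * (1 + (\<Sum>w\<in>V - e. c w t \<alpha>)))
      + real n * g n \<alpha>)"
  define I where "I = (\<Sum>t=1..n. (F (t - 1) - F t) * (1 + (\<Sum>w\<in>V - e. p w t))) + real n * F n"
  have int_R: "has_bochner_integral ?M R I"
  proof -
    \<comment> \<open>\<open>R\<close> is multiplied out so that only \<open>g\<close> and
      \<open>g * c\<close> have to be integrated.\<close>
    have "has_bochner_integral ?M
      (\<lambda>\<alpha>. (\<Sum>t=1..n. g (t - 1) \<alpha> - g t \<alpha> + (\<Sum>w\<in>V - e. g (t - 1) \<alpha> * c w t \<alpha> - g t \<alpha> * c w t \<alpha>))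
          + real n * g n \<alpha>)
      ((\<Sum>t=1..n. F (t - 1) - F t + (\<Sum>w\<in>V - e. F (t - 1) * p w t - F t * p w t)) + real n * F n)"
      by (intro has_bochner_integral_add has_bochner_integral_sum has_bochner_integral_diff
          has_bochner_integral_mult_right int_g int_gc)
    then show ?thesis
      by (simp add: R_def I_def distrib_left sum_distrib_left left_diff_distrib)
  qed
  have R_ge: "real (cover_time \<sigma> e) \<le> R \<alpha>"
    if "\<sigma> \<in> sorted_orderings V (\<lambda>v. alpha_point (kernel_z \<beta> (card V) (x v)) (\<alpha> v))" for \<sigma> \<alpha>
    using cover_time_le_indicator_sum[OF that finV e(1,2) alpha_point_pos]
    by (simp add: R_def g_def c_def z_def n_def)
  have "(\<integral>\<sigma>. real (cover_time \<sigma> e) \<partial>kernel_alpha_rounding \<beta> V x) \<le> integral\<^sup>L ?M R"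
    by (rule integral_kernel_alpha_rounding_le[OF finV _ _ R_ge])
       (use int_R in \<open>auto simp: has_bochner_integral_iff\<close>)
  also have "\<dots> = I" using int_R by (simp add: has_bochner_integral_iff)
  also have "I \<le> 1 + \<beta> * (\<Sum>t<n. F t)"
  proof -
    have p_le: "(\<Sum>w\<in>V - e. p w t) \<le> \<beta> * real t" if t: "t \<in> {1..n}" for t
    proof -
      have "(\<Sum>w\<in>V - e. p w t) \<le> (\<Sum>w\<in>V - e. \<Sum>s=1..t. z w s)"
        unfolding p_def C_def using z0 t by (intro sum_mono measure_alpha_point_le_le) auto
      also have "\<dots> \<le> (\<Sum>w\<in>V. \<Sum>s=1..t. z w s)"
        using finV z0 by (intro sum_mono2) (auto intro!: sum_nonneg)
      also have "\<dots> = (\<Sum>s=1..t. \<Sum>w\<in>V. z w s)" by (rule sum.swap)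
      \<comment> \<open>The LP capacities allow cumulative mass at most \<open>s\<close> by time
        \<open>s\<close>, which the factor \<open>\<beta> / s\<close> turns into kernel mass at most
        \<beta> per time step.\<close>
      also have "\<dots> \<le> (\<Sum>s=1..t. \<beta>)"
      proof (intro sum_mono)
        fix s assume s: "s \<in> {1..t}"
        have "(\<Sum>w\<in>V. \<Sum>r=1..s. X w r) = (\<Sum>r=1..s. \<Sum>w\<in>V. X w r)" by (rule sum.swap)
        also have "\<dots> \<le> (\<Sum>r=1..s. 1)"
          using feas s t by (intro sum_mono) (auto simp: X_def zero_ext_def lp_feasible_def n_def)
        finally have "(\<Sum>w\<in>V. \<Sum>r=1..s. X w r) \<le> real s" by simp
        then have "\<beta> / real s * (\<Sum>w\<in>V. \<Sum>r=1..s. X w r) \<le> \<beta> / real s * real s"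
          using \<open>1 < \<beta>\<close> by (intro mult_left_mono) auto
        then show "(\<Sum>w\<in>V. z w s) \<le> \<beta>" using s by (simp add: z_eq sum_distrib_left)
      qed
      finally show ?thesis by (simp add: mult.commute)
    qed
    have F_mono: "F t \<le> F (t - 1)" for t
    proof -
      interpret U: prob_space ?U by (rule prob_space_uniform_unit)
      have "D v t \<subseteq> D v (t - 1)" for v
        unfolding D_def using le_less_trans[of "enat (t - 1)" "enat t"] by auto
      then show ?thesis
        unfolding F_def using meas by (intro prod_mono conjI U.finite_measure_mono) (auto simp: D_def)
    qed
    have F0: "F 0 \<le> 1" "0 \<le> F n"
      unfolding F_def using prob_space.prob_le_1[OF prob_space_uniform_unit]
      by (auto intro!: prod_le_1 prod_nonneg)
    have "I \<le> (\<Sum>t=1..n. (F (t - 1) - F t) * (1 + \<beta> * real t)) + real n * F n"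
      unfolding I_def using F_mono p_le by (intro add_right_mono sum_mono mult_left_mono) auto
    \<comment> \<open>Summation by parts leaves \<open>- (1 + \<beta> * n) * F n\<close>, and the
      trivial bound for late edges adds \<open>n * F n\<close>. Their sum is nonpositive because
      \<open>\<beta> > 1\<close>.\<close>
    also have "\<dots> = F 0 + \<beta> * (\<Sum>t<n. F t) - (1 + (\<beta> - 1) * real n) * F n"
      unfolding sum_by_parts_affine by (simp add: algebra_simps)
    also have "\<dots> \<le> 1 + \<beta> * (\<Sum>t<n. F t)"
    proof -
      have "0 \<le> (1 + (\<beta> - 1) * real n) * F n"
        using \<open>1 < \<beta>\<close> F0 by (intro mult_nonneg_nonneg) auto
      then show ?thesis using F0 by linarith
    qed
    finally show ?thesis .
  qed
  also have "\<dots> \<le> \<beta>\<^sup>2 / (\<beta> - 1) * (\<Sum>t<n. max 0 (1 - y t))"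
  proof -
    define G where "G = (\<lambda>t. exp (- (\<Sum>s=1..t. \<beta> / real s * y s)))"
    have "F t \<le> G t" for t
    proof -
      have "F t \<le> (\<Prod>v\<in>e. exp (- (\<Sum>s=1..t. z v s)))"
        unfolding F_def D_def using z0 e(1)
        by (intro prod_mono conjI measure_alpha_point_greater_le) auto
      also have "\<dots> = exp (- (\<Sum>v\<in>e. \<Sum>s=1..t. z v s))"
        using e(3) by (simp add: exp_sum flip: sum_negf)
      also have "(\<Sum>v\<in>e. \<Sum>s=1..t. z v s) = (\<Sum>s=1..t. \<Sum>v\<in>e. z v s)" by (rule sum.swap)
      finally show ?thesis by (simp add: G_def y_def z_eq sum_distrib_left)
    qed
    then have "(\<Sum>t<n. F t) \<le> (\<Sum>t<n. G t)" by (intro sum_mono)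
    obtain m where m: "n = Suc m" using \<open>1 \<le> n\<close> by (cases n) auto
    have y0: "0 \<le> y t" for t unfolding y_def using X0 e(1) by (intro sum_nonneg) auto
    have "(\<beta> - 1) * (1 + \<beta> * (\<Sum>t<n. F t)) \<le> (\<beta> - 1) * (1 + \<beta> * (\<Sum>t<n. G t))"
      using \<open>1 < \<beta>\<close> \<open>(\<Sum>t<n. F t) \<le> (\<Sum>t<n. G t)\<close> by simp
    \<comment> \<open>The middle term, present for the sake of the induction, is given away
      here.\<close>
    also have "\<dots> \<le> \<beta> * (\<beta> - 1) * (\<Sum>t\<le>m. G t) + (\<beta> * real m + 1) * G m + (\<beta> - 1)"
    proof -
      have "0 \<le> (\<beta> * real m + 1) * G m" using \<open>1 < \<beta>\<close> by (simp add: G_def)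
      then show ?thesis by (simp add: m lessThan_Suc_atMost distrib_left mult_ac)
    qed
    also have "\<dots> \<le> \<beta>\<^sup>2 * (\<Sum>t\<le>m. max 0 (1 - y t))"
      unfolding G_def by (rule sum_exp_kernel_le) (use \<open>1 < \<beta>\<close> y0 in \<open>auto simp: y_def\<close>)
    finally show ?thesis
      using \<open>1 < \<beta>\<close> by (simp add: m lessThan_Suc_atMost pos_le_divide_eq mult.commute)
  qed
  also have "\<dots> \<le> \<beta>\<^sup>2 / (\<beta> - 1) * (\<Sum>t<n. u e (Suc t))"
  proof (intro mult_left_mono sum_mono)
    fix t assume t: "t \<in> {..<n}"
    \<comment> \<open>Mass up to and including \<open>t\<close> is mass strictly before
      \<open>Suc t\<close>, so the LP constraint at time \<open>Suc t\<close> applies. As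
      \<open>t < n\<close>, the zero extension changes nothing.\<close>
    have "y t = (\<Sum>v\<in>e. \<Sum>s\<in>{1..<Suc t}. x v s)"
      unfolding y_def using t by (intro sum.cong) (auto simp: X_def zero_ext_def)
    moreover have "0 \<le> u e (Suc t)" "1 \<le> u e (Suc t) + (\<Sum>v\<in>e. \<Sum>s\<in>{1..<Suc t}. x v s)"
      using feas \<open>e \<in> E\<close> t unfolding lp_feasible_def n_def
      by (simp_all del: sum.op_ivl_Suc)
    ultimately show "max 0 (1 - y t) \<le> u e (Suc t)" by simp
  qed (use \<open>1 < \<beta>\<close> in auto)
  also have "(\<Sum>t<n. u e (Suc t)) = (\<Sum>t=1..card V. u e t)"
    by (simp add: n_def sum.atLeast1_atMost_eq)
  finally show ?thesis .
qed

section \<open>Summing over all edges\<close>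

lemma kernel_alpha_rounding_approximation:
  assumes inst: "mssc_instance V E" and opt: "lp_optimal V E x u" and "1 < \<beta>"
  shows "(\<integral>\<sigma>. real (total_cover_time E \<sigma>) \<partial>kernel_alpha_rounding \<beta> V x)
    \<le> \<beta>\<^sup>2 / (\<beta> - 1) * real (mssc_opt V E)"
proof -
  have finV: "finite V" using inst by (simp add: mssc_instance_def)
  have feas: "lp_feasible V E x u" using opt by (simp add: lp_optimal_def)
  \<comment> \<open>The cover time of one edge is the total cover time of the family
    \<open>{e}\<close>.\<close>
  have "integrable (kernel_alpha_rounding \<beta> V x) (\<lambda>\<sigma>. real (cover_time \<sigma> e))" for e
    using integrable_total_cover_time[OF finV, of \<beta> x "{e}"] by (simp add: total_cover_time_def)
  then have "(\<integral>\<sigma>. real (total_cover_time E \<sigma>) \<partial>kernel_alpha_rounding \<beta> V x)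
    = (\<Sum>e\<in>E. \<integral>\<sigma>. real (cover_time \<sigma> e) \<partial>kernel_alpha_rounding \<beta> V x)"
    by (simp add: total_cover_time_def)
  also have "\<dots> \<le> (\<Sum>e\<in>E. \<beta>\<^sup>2 / (\<beta> - 1) * (\<Sum>t=1..card V. u e t))"
    using integral_cover_time_le[OF inst feas _ \<open>1 < \<beta>\<close>] by (intro sum_mono)
  also have "\<dots> = \<beta>\<^sup>2 / (\<beta> - 1) * lp_value V E u"
    by (simp add: lp_value_def sum_distrib_left)
  also have "\<dots> \<le> \<beta>\<^sup>2 / (\<beta> - 1) * real (mssc_opt V E)"
    using lp_value_le_mssc_opt[OF inst opt] \<open>1 < \<beta>\<close> by (intro mult_left_mono) auto
  finally show ?thesis .
qed

theorem theorem6: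
  fixes V :: "'v set" and E :: "'v set set"
    and x :: "'v \<Rightarrow> nat \<Rightarrow> real" and u :: "'v set \<Rightarrow> nat \<Rightarrow> real"
  assumes "mssc_instance V E"
    and "lp_optimal V E x u"
  shows "(\<forall>\<beta>::real. \<beta> > 1 \<longrightarrow>
            (\<integral>\<sigma>. real (total_cover_time E \<sigma>) \<partial>kernel_alpha_rounding \<beta> V x)
              \<le> \<beta>\<^sup>2 / (\<beta> - 1) * real (mssc_opt V E))
         \<and> (\<integral>\<sigma>. real (total_cover_time E \<sigma>) \<partial>kernel_alpha_rounding 2 V x)
              \<le> 4 * real (mssc_opt V E)"
proof (intro conjI allI impI)
  show "(\<integral>\<sigma>. real (total_cover_time E \<sigma>) \<partial>kernel_alpha_rounding 2 V x) \<le> 4 * real (mssc_opt V E)"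
    using kernel_alpha_rounding_approximation[OF assms, of 2] by simp
qed (rule kernel_alpha_rounding_approximation[OF assms])

end
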